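(* Let $t\geq 1$ and $d=\binom{2t}{t}-1$. For every $k$, every triangular submatrix $D_m$ of $A_{k,t}$ has $m\le d$, and for all sufficiently large $k$, $A_{k,t}$ contains $D_d$ as a submatrix. Equivalently, the maximum $m$ for which there exist $t$-subsets $A_1,\dots,A_m$ and $B_1,\dots,B_m$ of $[k]$ with $A_i\cap B_j\neq\emptyset$ if and only if $i\geq j$ is $\binom{2t}{t}-1$, for $k$ large enough.
   Context: $[k]=\{1,\dots,k\}$ and $A_{k,t}$ is the Boolean matrix with rows and columns indexed by all $t$-subsets of $[k]$, with entry $1$ at $(x,y)$ iff $x\cap y\neq\emptyset$. A submatrix is obtained by choosing ordered lists of distinct row indices and distinct column indices. $D_m$ denotes the $m\times m$ triangular Boolean matrix with ones on and below the main diagonal and zeros above it. *)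

theory Defs
  imports Complex_Main "HOL-Library.Ramsey"
begin

text \<open>
  A Boolean matrix is a function of a row index and a column index; the finite sets of row
  and column indices are passed separately wherever they matter.
\<close>

definition intersection_matrix :: "nat set \<Rightarrow> nat set \<Rightarrow> bool" where
  "intersection_matrix x y \<longleftrightarrow> x \<inter> y \<noteq> {}"

definition triangular_matrix :: "nat \<Rightarrow> nat \<Rightarrow> bool" where
  "triangular_matrix i j \<longleftrightarrow> j \<le> i"

text \<open>
  The matrix \<open>M\<close>, with rows \<open>R\<close> and columns \<open>C\<close>, contains the \<open>m \<times> n\<close> matrix \<open>N\<close>.
  List positions start at 0, so \<open>N\<close> is indexed by \<open>{0..<m} \<times> {0..<n}\<close>.
  The chosen rows (and columns) may appear in any order.
\<close>

definition has_submatrix ::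
  "'r set \<Rightarrow> 'c set \<Rightarrow> ('r \<Rightarrow> 'c \<Rightarrow> bool) \<Rightarrow> nat \<Rightarrow> nat \<Rightarrow> (nat \<Rightarrow> nat \<Rightarrow> bool) \<Rightarrow> bool" where
  "has_submatrix R C M m n N \<longleftrightarrow>
     (\<exists>rs cs. distinct rs \<and> set rs \<subseteq> R \<and> length rs = m \<and>
              distinct cs \<and> set cs \<subseteq> C \<and> length cs = n \<and>
              (\<forall>i<m. \<forall>j<n. M (rs ! i) (cs ! j) = N i j))"

text \<open>\<open>A\<^bsub>k,t\<^esub>\<close> contains \<open>D\<^sub>m\<close>; the index set \<open>nsets {1..k} t\<close> consists of the \<open>t\<close>-subsets of \<open>{1..k}\<close>.\<close>

definition contains_triangular :: "nat \<Rightarrow> nat \<Rightarrow> nat \<Rightarrow> bool" where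
  "contains_triangular k t m \<longleftrightarrow>
     has_submatrix (nsets {1..k} t) (nsets {1..k} t) intersection_matrix m m triangular_matrix"

definition triangular_set_systems :: "nat \<Rightarrow> nat \<Rightarrow> nat \<Rightarrow> bool" where
  "triangular_set_systems k t m \<longleftrightarrow>
     (\<exists>A B :: nat \<Rightarrow> nat set.
        (\<forall>i\<in>{1..m}. A i \<in> nsets {1..k} t \<and> B i \<in> nsets {1..k} t) \<and>
        (\<forall>i\<in>{1..m}. \<forall>j\<in>{1..m}. A i \<inter> B j \<noteq> {} \<longleftrightarrow> i \<ge> j))"

end

theory Submission
  imports Defs "HOL-Computational_Algebra.Polynomial"
begin

text \<open>
  The \<open>m \<times> m\<close> triangular pattern, shifted by one and padded with a fresh set at each end, is a skew
  Bollobas system of \<open>m + 1\<close> pairs \<open>(X i, Y i)\<close>: \<open>X i\<close> and \<open>Y i\<close> are disjoint, and \<open>X i\<close> meets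
  \<open>Y j\<close> for \<open>j < i\<close>. The matrix of products \<open>\<Prod>v\<in>Y j. \<Prod>u\<in>X i. v - u\<close> is then triangular with nonzero
  diagonal, whereas expanding \<open>\<Prod>v\<in>Y j. p v\<close> for a polynomial \<open>p\<close> of degree \<open>a\<close> in the coefficients of
  \<open>p\<close> factors it through the monomials of degree \<open>b\<close> in \<open>a + 1\<close> variables, so its rank is at most
  \<open>(a + b) choose a\<close>. The matching construction, in which \<open>X i\<close>
  meets \<open>Y j\<close> exactly for \<open>j < i\<close>, follows Pascal's rule: given systems of set sizes
  \<open>(a + 1, b)\<close> and \<open>(a, b + 1)\<close> on disjoint ground sets, add one new point to every \<open>Y j\<close> of the first
  and to every \<open>X i\<close> of the second, and concatenate.
\<close>

section \<open>Linear algebra and the upper bound for skew systems\<close>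

text \<open>A triangular matrix with nonzero diagonal has rank \<open>n\<close>, while a
  factorization through \<open>S\<close> allows rank at most \<open>card S\<close>. The proof is
  Gaussian elimination on the left factor, removing one row and one coordinate of \<open>S\<close>
  per induction step.\<close>

lemma triangular_factorization_le:
  fixes x y :: "nat \<Rightarrow> 'k \<Rightarrow> 'f::field"
  assumes "finite S"
    and "\<And>i. i < n \<Longrightarrow> (\<Sum>s\<in>S. x i s * y i s) \<noteq> 0"
    and "\<And>i j. j < i \<Longrightarrow> i < n \<Longrightarrow> (\<Sum>s\<in>S. x i s * y j s) = 0"
  shows "n \<le> card S"
  using assms
proof (induction n arbitrary: S x)
  case 0
  then show ?case by simp
next
  case (Suc n)
  have "(\<Sum>s\<in>S. x n s * y n s) \<noteq> 0" using Suc.prems(2) by simp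
  then have "\<exists>k\<in>S. x n k \<noteq> 0" by (rule contrapos_np) simp
  then obtain k where k: "k \<in> S" "x n k \<noteq> 0" ..
  define x' where "x' i s = x i s - x i k / x n k * x n s" for i s
  have eq: "(\<Sum>s\<in>S - {k}. x' i s * y j s) = (\<Sum>s\<in>S. x i s * y j s)" if "j < n" for i j
  proof -
    have "(\<Sum>s\<in>S - {k}. x' i s * y j s) = (\<Sum>s\<in>S. x' i s * y j s)"
      using k Suc.prems(1) by (intro sum.mono_neutral_left) (auto simp: x'_def)
    also have "\<dots> = (\<Sum>s\<in>S. x i s * y j s) - x i k / x n k * (\<Sum>s\<in>S. x n s * y j s)"
      by (simp add: x'_def left_diff_distrib sum_subtractf sum_distrib_left mult.assoc)
    finally show ?thesis using Suc.prems(3)[of j n] that by simp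
  qed
  have "n \<le> card (S - {k})"
  proof (rule Suc.IH)
    show "finite (S - {k})" using Suc.prems(1) by simp
    show "(\<Sum>s\<in>S - {k}. x' i s * y i s) \<noteq> 0" if "i < n" for i
      using that Suc.prems(2)[of i] by (simp add: eq)
    show "(\<Sum>s\<in>S - {k}. x' i s * y j s) = 0" if "j < i" "i < n" for i j
      using that Suc.prems(3)[of j i] by (simp add: eq)
  qed
  moreover have "card S > 0" using k Suc.prems(1) card_gt_0_iff by blast
  ultimately show ?case using k Suc.prems(1) by (simp add: card_Diff_singleton)
qed

text \<open>Multiplying out, \<open>g\<close> selects one term of each factor, and \<open>e\<close>
  counts how often each power is selected. Grouping by \<open>e\<close> separates the dependence on
  \<open>c\<close> from that on \<open>B\<close> and \<open>w\<close>; only \<open>card B\<close>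
  enters the index set of the sum.\<close>

lemma prod_power_sum_expansion:
  fixes c :: "nat \<Rightarrow> 'f::comm_semiring_1" and w :: "'b \<Rightarrow> 'f"
  assumes "finite B"
  shows "(\<Prod>v\<in>B. \<Sum>k<m. c k * w v ^ k) =
    (\<Sum>e\<in>{e. length e = m \<and> sum_list e = card B}. (\<Prod>k<m. c k ^ (e ! k)) *
       (\<Sum>g\<in>{g \<in> B \<rightarrow>\<^sub>E {..<m}. map (\<lambda>k. card {v \<in> B. g v = k}) [0..<m] = e}.
          \<Prod>v\<in>B. w v ^ g v))"
proof -
  let ?F = "B \<rightarrow>\<^sub>E {..<m}" and ?E = "{e::nat list. length e = m \<and> sum_list e = card B}"
  define E where "E g = map (\<lambda>k. card {v \<in> B. g v = k}) [0..<m]" for g :: "'b \<Rightarrow> nat"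
  have finF: "finite ?F" using assms by (intro finite_PiE) auto
  have finE: "finite ?E"
    by (rule finite_subset[OF _ finite_lists_length_eq[of "{..card B}" m]])
      (auto dest: member_le_sum_list)
  have EF: "E ` ?F \<subseteq> ?E"
  proof clarify
    fix g assume g: "g \<in> ?F"
    have "card B = (\<Sum>k<m. card {v \<in> B. g v = k})"
      using sum.group[of B "{..<m}" g "\<lambda>_. 1::nat"] g assms
      by (simp add: PiE_def Pi_def image_subset_iff)
    then show "length (E g) = m \<and> sum_list (E g) = card B"
      by (simp add: E_def sum_list_distinct_conv_sum_set atLeast0LessThan)
  qed
  have "(\<Prod>v\<in>B. \<Sum>k<m. c k * w v ^ k) = (\<Sum>g\<in>?F. \<Prod>v\<in>B. c (g v) * w v ^ g v)"
    using assms by (subst prod_sum_PiE) auto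
  also have "\<dots> = (\<Sum>g\<in>?F. (\<Prod>k<m. c k ^ (E g ! k)) * (\<Prod>v\<in>B. w v ^ g v))"
  proof (rule sum.cong[OF refl])
    fix g assume g: "g \<in> ?F"
    have "(\<Prod>v\<in>B. c (g v)) = (\<Prod>k<m. \<Prod>v\<in>{v \<in> B. g v = k}. c (g v))"
      using g assms by (subst prod.group) auto
    also have "\<dots> = (\<Prod>k<m. c k ^ (E g ! k))"
      by (intro prod.cong) (auto simp: E_def)
    finally show "(\<Prod>v\<in>B. c (g v) * w v ^ g v) = (\<Prod>k<m. c k ^ (E g ! k)) * (\<Prod>v\<in>B. w v ^ g v)"
      by (simp add: prod.distrib)
  qed
  also have "\<dots> = (\<Sum>e\<in>?E. \<Sum>g\<in>{g \<in> ?F. E g = e}. (\<Prod>k<m. c k ^ (E g ! k)) * (\<Prod>v\<in>B. w v ^ g v))"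
    by (rule sum.group[OF finF finE EF, symmetric])
  also have "\<dots> = (\<Sum>e\<in>?E. (\<Prod>k<m. c k ^ (e ! k)) * (\<Sum>g\<in>{g \<in> ?F. E g = e}. \<Prod>v\<in>B. w v ^ g v))"
    unfolding sum_distrib_left by (intro sum.cong) auto
  finally show ?thesis unfolding E_def .
qed

theorem skew_bollobas:
  fixes X Y :: "nat \<Rightarrow> 'a set"
  assumes X: "\<And>i. i < n \<Longrightarrow> finite (X i) \<and> card (X i) = a"
    and Y: "\<And>i. i < n \<Longrightarrow> finite (Y i) \<and> card (Y i) = b"
    and disj: "\<And>i. i < n \<Longrightarrow> X i \<inter> Y i = {}"
    and meet: "\<And>i j. j < i \<Longrightarrow> i < n \<Longrightarrow> X i \<inter> Y j \<noteq> {}"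
  shows "n \<le> (a + b) choose a"
proof -
  let ?U = "\<Union>i<n. X i \<union> Y i"
  have "finite ?U" using X Y by auto
  from finite_imp_inj_to_nat_seg[OF this] obtain f :: "'a \<Rightarrow> nat" where f: "inj_on f ?U"
    by (elim exE conjE)
  \<comment> \<open>As \<open>f\<close> is injective on \<open>?U\<close>, the product of the
    differences \<open>w v - w u\<close> vanishes exactly when \<open>X i\<close> and
    \<open>Y j\<close> share a point.\<close>
  define w where "w v = real (f v)" for v
  define p where "p i = (\<Prod>u\<in>X i. [:- w u, 1:])" for i
  let ?E = "{e::nat list. length e = Suc a \<and> sum_list e = b}"
  define x where "x i e = (\<Prod>k<Suc a. coeff (p i) k ^ (e ! k))" for i and e :: "nat list"
  define y where "y j e = (\<Sum>g\<in>{g \<in> Y j \<rightarrow>\<^sub>E {..<Suc a}.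
    map (\<lambda>k. card {v \<in> Y j. g v = k}) [0..<Suc a] = e}. \<Prod>v\<in>Y j. w v ^ g v)" for j e
  have poly: "poly (p i) z = (\<Sum>k<Suc a. coeff (p i) k * z ^ k)" if "i < n" for i z
  proof -
    have "degree (p i) \<le> a"
      using degree_prod_sum_le[of "X i" "\<lambda>u. [:- w u, 1:]"] X[OF that] by (simp add: p_def)
    then show ?thesis
      unfolding poly_altdef by (intro sum.mono_neutral_left) (auto simp: coeff_eq_0)
  qed
  have fact: "(\<Sum>e\<in>?E. x i e * y j e) = (\<Prod>v\<in>Y j. \<Prod>u\<in>X i. w v - w u)" if "i < n" "j < n" for i j
  proof -
    have "(\<Prod>v\<in>Y j. \<Prod>u\<in>X i. w v - w u) = (\<Prod>v\<in>Y j. poly (p i) (w v))"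
      by (simp add: p_def poly_prod)
    also have "\<dots> = (\<Prod>v\<in>Y j. \<Sum>k<Suc a. coeff (p i) k * w v ^ k)"
      using that by (simp add: poly del: sum.lessThan_Suc)
    also have "\<dots> = (\<Sum>e\<in>?E. x i e * y j e)"
      using Y[OF \<open>j < n\<close>] unfolding x_def y_def by (subst prod_power_sum_expansion) auto
    finally show ?thesis by simp
  qed
  have finE: "finite ?E"
    by (rule finite_subset[OF _ finite_lists_length_eq[of "{..b}" "Suc a"]])
      (auto dest: member_le_sum_list)
  have "n \<le> card ?E"
  proof (rule triangular_factorization_le[OF finE])
    show "(\<Sum>e\<in>?E. x i e * y i e) \<noteq> 0" if "i < n" for i
    proof -
      have "w v \<noteq> w u" if "v \<in> Y i" "u \<in> X i" for u v
        using inj_onD[OF f, of v u] that disj[OF \<open>i < n\<close>] \<open>i < n\<close> unfolding w_def by auto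
      then show ?thesis using that X Y by (simp add: fact)
    qed
    show "(\<Sum>e\<in>?E. x i e * y j e) = 0" if "j < i" "i < n" for i j
    proof -
      obtain u where "u \<in> X i" "u \<in> Y j" using meet[OF \<open>j < i\<close> \<open>i < n\<close>] by auto
      then show ?thesis using that X[of i] Y[of j] by (auto simp: fact)
    qed
  qed
  also have "card ?E = (a + b) choose a"
    using binomial_symmetric[of a "a + b"] by (simp add: card_length_sum_list add.commute[of b])
  finally show ?thesis .
qed

section \<open>Construction of extremal skew systems\<close>

text \<open>The lower end \<open>l\<close> of the ground interval is arbitrary so that the induction
  can place the second system entirely above the first.\<close>

lemma exists_skew_system:
  fixes a b l :: nat
  shows "\<exists>u X Y. \<forall>i<(a + b) choose a. X i \<in> nsets {l<..u} a \<and> Y i \<in> nsets {l<..u} b \<and>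
    (\<forall>j<(a + b) choose a. X i \<inter> Y j \<noteq> {} \<longleftrightarrow> j < i)"
proof (induction "a + b" arbitrary: a b l)
  case 0
  then show ?case by (intro exI[of _ 0] exI[of _ "\<lambda>_. {}"]) (auto simp: nsets_def)
next
  case (Suc s)
  show ?case
  proof (cases "a = 0 \<or> b = 0")
    case True
    then have one: "(a + b) choose a = 1" by auto
    \<comment> \<open>A single pair suffices; it is disjoint because one of its two sets is
      empty.\<close>
    show ?thesis
      by (rule exI[of _ "l + a + b"], rule exI[of _ "\<lambda>_. {l<..l + a}"],
          rule exI[of _ "\<lambda>_. {l<..l + b}"]) (use True in \<open>auto simp: one nsets_def\<close>)
  next
    case False
    then obtain a' b' where ab: "a = Suc a'" "b = Suc b'" by (meson not0_implies_Suc)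
    then have s: "s = a + b'" "s = a' + b" using Suc.hyps(2) by simp_all
    let ?M = "(a + b') choose a" and ?N = "(a' + b) choose a'"
    have pascal: "(a + b) choose a = ?M + ?N" by (simp add: ab)
    obtain u X Y where XY: "\<forall>i<?M. X i \<in> nsets {l<..u} a \<and> Y i \<in> nsets {l<..u} b' \<and>
        (\<forall>j<?M. X i \<inter> Y j \<noteq> {} \<longleftrightarrow> j < i)"
      using Suc.hyps(1)[OF s(1), of l] by blast
    \<comment> \<open>The point \<open>z\<close> separates the two ground sets. The maximum with
      \<open>l\<close> is needed because \<open>u\<close> may lie below \<open>l\<close>, when the
      first interval is empty; likewise for \<open>top\<close>.\<close>
    define z where "z = Suc (max l u)"
    obtain u' X' Y' where XY': "\<forall>i<?N. X' i \<in> nsets {z<..u'} a' \<and> Y' i \<in> nsets {z<..u'} b \<and>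
        (\<forall>j<?N. X' i \<inter> Y' j \<noteq> {} \<longleftrightarrow> j < i)"
      using Suc.hyps(1)[OF s(2), of z] by blast
    define P where "P i = (if i < ?M then X i else insert z (X' (i - ?M)))" for i
    define Q where "Q i = (if i < ?M then insert z (Y i) else Y' (i - ?M))" for i
    define top where "top = max z u'"
    have X: "X i \<subseteq> {l<..u}" "finite (X i)" "card (X i) = a"
      and Y: "Y i \<subseteq> {l<..u}" "finite (Y i)" "card (Y i) = b'" if "i < ?M" for i
      using XY that by (auto simp: nsets_def)
    have X': "X' i \<subseteq> {z<..u'}" "finite (X' i)" "card (X' i) = a'"
      and Y': "Y' i \<subseteq> {z<..u'}" "finite (Y' i)" "card (Y' i) = b" if "i < ?N" for i
      using XY' that by (auto simp: nsets_def)
    have zX: "z \<notin> X i" and zY: "z \<notin> Y i" if "i < ?M" for i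
      using X(1)[OF that] Y(1)[OF that] by (fastforce simp: z_def)+
    have zX': "z \<notin> X' i" and zY': "z \<notin> Y' i" if "i < ?N" for i
      using X'(1)[OF that] Y'(1)[OF that] by auto
    have sub: "{l<..u} \<subseteq> {l<..top}" "{z<..u'} \<subseteq> {l<..top}" "z \<in> {l<..top}"
      by (auto simp: top_def z_def)
    have P: "P i \<in> nsets {l<..top} a" if "i < ?M + ?N" for i
    proof (cases "i < ?M")
      case True
      then show ?thesis using X[OF True] sub by (auto simp: P_def nsets_def)
    next
      case False
      then have i: "i - ?M < ?N" using that by linarith
      show ?thesis using X'[OF i] zX'[OF i] sub False by (auto simp: P_def nsets_def ab)
    qed
    have Q: "Q i \<in> nsets {l<..top} b" if "i < ?M + ?N" for i
    proof (cases "i < ?M")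
      case True
      then show ?thesis using Y[OF True] zY[OF True] sub by (auto simp: Q_def nsets_def ab)
    next
      case False
      then have i: "i - ?M < ?N" using that by linarith
      show ?thesis using Y'[OF i] sub False by (auto simp: Q_def nsets_def)
    qed
    have PQ: "P i \<inter> Q j \<noteq> {} \<longleftrightarrow> j < i" if "i < ?M + ?N" "j < ?M + ?N" for i j
    proof -
      \<comment> \<open>The two diagonal blocks inherit the pattern, since \<open>z\<close> is added
        on one side only. Above them the ground sets are disjoint; below them every pair meets in
        \<open>z\<close>.\<close>
      consider "i < ?M" "j < ?M" | "i < ?M" "\<not> j < ?M" | "\<not> i < ?M" "j < ?M" | "\<not> i < ?M" "\<not> j < ?M"
        by blast
      then show ?thesis
      proof cases
        case 1
        then show ?thesis using XY zX[of i] by (simp add: P_def Q_def)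
      next
        case 2
        then have j: "j - ?M < ?N" using that by linarith
        have "X i \<inter> Y' (j - ?M) = {}" using X(1)[OF 2(1)] Y'(1)[OF j] by (fastforce simp: z_def)
        then show ?thesis using 2 by (simp add: P_def Q_def)
      next
        case 3
        then show ?thesis by (simp add: P_def Q_def)
      next
        case 4
        then have "i - ?M < ?N" "j - ?M < ?N" using that by linarith+
        then have "X' (i - ?M) \<inter> Y' (j - ?M) \<noteq> {} \<longleftrightarrow> j - ?M < i - ?M" "z \<notin> Y' (j - ?M)"
          using XY' zY' by auto
        then show ?thesis using 4 by (auto simp: P_def Q_def)
      qed
    qed
    have "\<forall>i<?M + ?N. P i \<in> nsets {l<..top} a \<and> Q i \<in> nsets {l<..top} b \<and>
        (\<forall>j<?M + ?N. P i \<inter> Q j \<noteq> {} \<longleftrightarrow> j < i)"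
      by (intro allI impI conjI P Q PQ)
    then show ?thesis unfolding pascal by (intro exI)
  qed
qed

section \<open>Triangular submatrices and the shift to skew systems\<close>

lemma contains_triangular_iff: "contains_triangular k t m \<longleftrightarrow> triangular_set_systems k t m"
proof
  assume "contains_triangular k t m"
  then obtain rs cs where *: "set rs \<subseteq> nsets {1..k} t" "length rs = m"
    "set cs \<subseteq> nsets {1..k} t" "length cs = m"
    "\<forall>i<m. \<forall>j<m. intersection_matrix (rs ! i) (cs ! j) = triangular_matrix i j"
    unfolding contains_triangular_def has_submatrix_def by blast
  show "triangular_set_systems k t m"
    unfolding triangular_set_systems_def
  proof (intro exI conjI ballI)
    fix i assume i: "i \<in> {1..m}"
    then show "rs ! (i - 1) \<in> nsets {1..k} t" "cs ! (i - 1) \<in> nsets {1..k} t"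
      using * nth_mem[of "i - 1" rs] nth_mem[of "i - 1" cs] by auto
    fix j assume "j \<in> {1..m}"
    with i have "i - 1 < m" "j - 1 < m" by auto
    then have "intersection_matrix (rs ! (i - 1)) (cs ! (j - 1)) \<longleftrightarrow> triangular_matrix (i - 1) (j - 1)"
      using *(5) by blast
    then show "rs ! (i - 1) \<inter> cs ! (j - 1) \<noteq> {} \<longleftrightarrow> i \<ge> j"
      using i \<open>j \<in> {1..m}\<close> by (auto simp: intersection_matrix_def triangular_matrix_def)
  qed
next
  assume "triangular_set_systems k t m"
  then obtain A B :: "nat \<Rightarrow> nat set"
    where AB: "\<forall>i\<in>{1..m}. A i \<in> nsets {1..k} t \<and> B i \<in> nsets {1..k} t"
      and tri: "\<forall>i\<in>{1..m}. \<forall>j\<in>{1..m}. A i \<inter> B j \<noteq> {} \<longleftrightarrow> i \<ge> j"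
    unfolding triangular_set_systems_def by blast
  \<comment> \<open>Distinctness comes from the pattern: if \<open>A i = A j\<close>, then
    \<open>A i\<close> meets \<open>B j\<close> and \<open>A j\<close> meets \<open>B i\<close>, so
    \<open>i = j\<close>; similarly for \<open>B\<close>.\<close>
  have "inj_on A {1..m}" "inj_on B {1..m}"
    by (rule inj_onI, rule le_antisym; use tri in \<open>metis order_refl\<close>)+
  moreover have "set [1..<Suc m] = {1..m}" by auto
  moreover have "map A [1..<Suc m] ! i = A (Suc i)" "map B [1..<Suc m] ! i = B (Suc i)"
    if "i < m" for i using that by (simp_all del: upt_Suc)
  ultimately have "distinct (map A [1..<Suc m]) \<and> set (map A [1..<Suc m]) \<subseteq> nsets {1..k} t \<and>
      length (map A [1..<Suc m]) = m \<and>
      distinct (map B [1..<Suc m]) \<and> set (map B [1..<Suc m]) \<subseteq> nsets {1..k} t \<and>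
      length (map B [1..<Suc m]) = m \<and>
      (\<forall>i<m. \<forall>j<m. intersection_matrix (map A [1..<Suc m] ! i) (map B [1..<Suc m] ! j) =
        triangular_matrix i j)"
    using AB tri
    by (auto simp: distinct_map intersection_matrix_def triangular_matrix_def simp del: upt_Suc)
  then show "contains_triangular k t m"
    unfolding contains_triangular_def has_submatrix_def by blast
qed

lemma triangular_set_systems_less:
  assumes "triangular_set_systems k t m"
  shows "m < (2 * t) choose t"
proof -
  obtain A B :: "nat \<Rightarrow> nat set"
    where AB: "\<forall>i\<in>{1..m}. A i \<in> nsets {1..k} t \<and> B i \<in> nsets {1..k} t"
      and tri: "\<forall>i\<in>{1..m}. \<forall>j\<in>{1..m}. A i \<inter> B j \<noteq> {} \<longleftrightarrow> i \<ge> j"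
    using assms unfolding triangular_set_systems_def by blast
  \<comment> \<open>With \<open>B\<close> shifted by one, the condition \<open>i \<ge> j\<close>
    becomes \<open>j < i\<close>. The two padding blocks lie above \<open>k\<close> and are disjoint
    from each other, which matters when \<open>m = 0\<close> and they form the only pair.\<close>
  define X where "X i = (if i = 0 then {k<..k + t} else A i)" for i
  define Y where "Y i = (if i = m then {k + t<..k + t + t} else B (Suc i))" for i
  have A: "A i \<subseteq> {1..k}" "finite (A i)" "card (A i) = t"
    and B: "B i \<subseteq> {1..k}" "finite (B i)" "card (B i) = t" if "i \<in> {1..m}" for i
    using AB that by (auto simp: nsets_def)
  have "Suc m \<le> (t + t) choose t"
  proof (rule skew_bollobas)
    fix i assume i: "i < Suc m"
    show "finite (X i) \<and> card (X i) = t" using A[of i] i by (auto simp: X_def)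
    show "finite (Y i) \<and> card (Y i) = t" using B[of "Suc i"] i by (auto simp: Y_def)
    show "X i \<inter> Y i = {}"
    proof -
      have "A i \<inter> B (Suc i) = {}" if "i \<noteq> 0" "i \<noteq> m"
        using tri[rule_format, of i "Suc i"] that i by auto
      moreover have "A i \<subseteq> {1..k}" if "i \<noteq> 0" using A(1) that i by simp
      moreover have "B (Suc i) \<subseteq> {1..k}" if "i \<noteq> m" using B(1) that i by simp
      ultimately show ?thesis by (cases "i = 0"; cases "i = m") (force simp: X_def Y_def)+
    qed
    show "X i \<inter> Y j \<noteq> {}" if "j < i" for j
      using tri[rule_format, of i "Suc j"] that i by (auto simp: X_def Y_def)
  qed
  then show ?thesis by (simp add: mult_2)
qed

lemma exists_triangular_set_systems:
  "\<exists>k0. \<forall>k\<ge>k0. triangular_set_systems k t ((2 * t choose t) - 1)"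
proof -
  let ?N = "2 * t choose t"
  obtain u :: nat and X Y where XY: "\<forall>i<?N. X i \<in> nsets {0<..u} t \<and> Y i \<in> nsets {0<..u} t \<and>
      (\<forall>j<?N. X i \<inter> Y j \<noteq> {} \<longleftrightarrow> j < i)"
    using exists_skew_system[where a=t and b=t and l=0, folded mult_2] by (elim exE) (rule that)
  have "triangular_set_systems k t (?N - 1)" if "k \<ge> u" for k
    unfolding triangular_set_systems_def
  \<comment> \<open>The shift is undone: the sets \<open>X 0\<close> and \<open>Y (?N - 1)\<close>
    are discarded, which costs the one index in \<open>?N - 1\<close>.\<close>
  proof (rule exI[of _ X], rule exI[of _ "\<lambda>j. Y (j - 1)"], intro conjI ballI)
    fix i assume i: "i \<in> {1..?N - 1}"
    then have i': "i < ?N" "i - 1 < ?N" by auto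
    have "nsets {0<..u} t \<subseteq> nsets {1..k} t" using that by (intro nsets_mono) auto
    then show "X i \<in> nsets {1..k} t" "Y (i - 1) \<in> nsets {1..k} t" using XY i' by auto
    fix j assume "j \<in> {1..?N - 1}"
    then have "j - 1 < ?N" "j \<ge> 1" by auto
    then have "X i \<inter> Y (j - 1) \<noteq> {} \<longleftrightarrow> j - 1 < i" using XY i' by blast
    then show "X i \<inter> Y (j - 1) \<noteq> {} \<longleftrightarrow> i \<ge> j" using \<open>j \<ge> 1\<close> by linarith
  qed
  then show ?thesis by blast
qed

theorem theorem2:
  fixes t d :: nat
  assumes "t \<ge> 1"
    and "d = ((2 * t) choose t) - 1"
  shows "(\<forall>k m. contains_triangular k t m \<longrightarrow> m \<le> d)
       \<and> (\<exists>k0. \<forall>k\<ge>k0. contains_triangular k t d)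
       \<and> (\<exists>k0. \<forall>k\<ge>k0. triangular_set_systems k t d
                      \<and> (\<forall>m. triangular_set_systems k t m \<longrightarrow> m \<le> d))"
proof -
  have "m \<le> d" if "triangular_set_systems k t m" for k m
    using triangular_set_systems_less[OF that] assms(2) by linarith
  then show ?thesis
    using exists_triangular_set_systems[of t] unfolding contains_triangular_iff assms(2) by blast
qed

end
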